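(* Let $(\mathbb{B}, \|\cdot\|)$ be a nonzero real or complex normed linear space. Then the following are equivalent: (a) $\|\cdot\|^2$ arises from an inner product on $\mathbb{B}$ (a real inner product if $\mathbb{B}$ is a real normed linear space, a complex inner product if $\mathbb{B}$ is a complex normed linear space); (b) there exists an integer $n \geqslant 3$ such that $\mathbb{B}$, with the metric $d(x,y) = \|x-y\|$, is strongly $n$-point homogeneous; (c) for every integer $n \geqslant 3$, $\mathbb{B}$, with the metric $d(x,y) = \|x-y\|$, is strongly $n$-point homogeneous.
   Context: "$\|\cdot\|^2$ arises from an inner product" means there is an inner product $\langle\cdot,\cdot\rangle$ on $\mathbb{B}$ (over the scalar field of $\mathbb{B}$) with $\|f\|^2 = \langle f,f\rangle$ for all $f \in \mathbb{B}$. No completeness or separability is assumed, and the dimension may be finite or infinite. An isometry between metric spaces is a distance-preserving map; it is not assumed to be linear, nor surjective unless called "onto". For an integer $n \geqslant 1$, a metric space $(X,d)$ is strongly $n$-point homogeneous if, given subsets $Y, Y' \subseteq X$ with $|Y| = |Y'| \leqslant n$, each isometry $T : Y \to Y'$ can be extended to an onto isometry $X \to X$. *)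

theory Defs
  imports "HOL-Analysis.Analysis"
begin

text \<open>
  Complex normed spaces, as the complex counterpart of class \<open>real_normed_vector\<close>.
  The real structure is the restriction of scalars; the distance
  \<open>dist x y = norm (x - y)\<close> is inherited.
\<close>

class scaleC = scaleR +
  fixes scaleC :: "complex \<Rightarrow> 'a \<Rightarrow> 'a"  (infixr \<open>*\<^sub>C\<close> 75)
  assumes scaleR_scaleC: "scaleR r x = complex_of_real r *\<^sub>C x"

class complex_normed_vector = scaleC + real_normed_vector +
  assumes scaleC_add_right: "a *\<^sub>C (x + y) = a *\<^sub>C x + a *\<^sub>C y"
    and scaleC_add_left: "(a + b) *\<^sub>C x = a *\<^sub>C x + b *\<^sub>C x"
    and scaleC_scaleC: "a *\<^sub>C (b *\<^sub>C x) = (a * b) *\<^sub>C x"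
    and scaleC_one: "1 *\<^sub>C x = x"
    and norm_scaleC: "norm (a *\<^sub>C x) = cmod a * norm x"

instantiation complex :: complex_normed_vector
begin

definition scaleC_complex :: "complex \<Rightarrow> complex \<Rightarrow> complex"
  where "scaleC_complex a x = a * x"

instance
  by standard (auto simp: scaleC_complex_def scaleR_conv_of_real algebra_simps norm_mult)

end

definition real_inner_product :: "('a::real_vector \<Rightarrow> 'a \<Rightarrow> real) \<Rightarrow> bool"
  where "real_inner_product ip \<longleftrightarrow>
    (\<forall>x y. ip x y = ip y x) \<and>
    (\<forall>x y z. ip (x + y) z = ip x z + ip y z) \<and>
    (\<forall>r x y. ip (r *\<^sub>R x) y = r * ip x y) \<and>
    (\<forall>x. 0 \<le> ip x x) \<and>
    (\<forall>x. ip x x = 0 \<longleftrightarrow> x = 0)"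

text \<open>Convention: linear in the first argument, conjugate-linear in the second.\<close>

definition complex_inner_product :: "('a::complex_normed_vector \<Rightarrow> 'a \<Rightarrow> complex) \<Rightarrow> bool"
  where "complex_inner_product ip \<longleftrightarrow>
    (\<forall>x y. ip x y = cnj (ip y x)) \<and>
    (\<forall>x y z. ip (x + y) z = ip x z + ip y z) \<and>
    (\<forall>c x y. ip (c *\<^sub>C x) y = c * ip x y) \<and>
    (\<forall>x. ip x x \<in> \<real> \<and> 0 \<le> Re (ip x x)) \<and>
    (\<forall>x. ip x x = 0 \<longleftrightarrow> x = 0)"

definition isometry_between ::
    "'a::metric_space set \<Rightarrow> 'b::metric_space set \<Rightarrow> ('a \<Rightarrow> 'b) \<Rightarrow> bool"
  where "isometry_between X Y f \<longleftrightarrow>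
    f ` X \<subseteq> Y \<and> (\<forall>x\<in>X. \<forall>y\<in>X. dist (f x) (f y) = dist x y)"

text \<open>Finiteness is explicit because \<open>card\<close> is 0 on infinite sets.\<close>

definition strongly_point_homogeneous :: "nat \<Rightarrow> 'a::metric_space set \<Rightarrow> bool"
  where "strongly_point_homogeneous n X \<longleftrightarrow>
    (\<forall>Y Y' T. Y \<subseteq> X \<and> Y' \<subseteq> X \<and> finite Y \<and> finite Y' \<and> card Y = card Y' \<and> card Y \<le> n \<and>
       isometry_between Y Y' T \<longrightarrow>
       (\<exists>S. isometry_between X X S \<and> S ` X = X \<and> (\<forall>y\<in>Y. S y = T y)))"

end

theory Submission
  imports Defs
begin

text \<open>
  In an inner product space, a partial isometry on finitely many points is extended by
  adding one point at a time: the reflection in the perpendicular bisector of the current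
  image of the new point and its desired image fixes the images of all earlier points.

  Conversely, let the space be strongly 3-point homogeneous. If \<open>norm x = norm y\<close>, then the map
  of \<open>{0, x, y}\<close> fixing \<open>0\<close> and exchanging \<open>x\<close> and \<open>y\<close> extends to an onto isometry, which is linear by
  Mazur--Ulam, so \<open>norm (a x + b y) = norm (b x + a y)\<close> (Ficken's condition). With \<open>u = x + y\<close> and
  \<open>v = x - y\<close> this says that \<open>norm (u + v) = norm (u - v)\<close> implies
  \<open>norm (s u + t v) = norm (s u - t v)\<close>. In a plane spanned by two unit vectors that are
  orthogonal in this sense, all Euclidean reflections are then isometries, so the norm is
  Euclidean. Hence the norm squared is a quadratic form on every plane, and polarization
  gives the inner product.
\<close>

section \<open>Inner product spaces are homogeneous\<close>

lemma real_inner_productD: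
  assumes "real_inner_product ip"
  shows "ip x y = ip y x" "ip (x + y) z = ip x z + ip y z" "ip (r *\<^sub>R x) y = r * ip x y"
    "ip x (y + z) = ip x y + ip x z" "ip x (r *\<^sub>R y) = r * ip x y"
    "ip (x - y) z = ip x z - ip y z" "ip x (y - z) = ip x y - ip x z"
    "ip x x = 0 \<longleftrightarrow> x = 0"
proof -
  have sym: "ip x y = ip y x" and add: "ip (x + y) z = ip x z + ip y z"
    and scale: "ip (r *\<^sub>R x) y = r * ip x y" for x y z r
    using assms by (auto simp: real_inner_product_def)
  show "ip x y = ip y x" "ip (x + y) z = ip x z + ip y z" "ip (r *\<^sub>R x) y = r * ip x y"
    by (fact sym add scale)+
  show "ip x (y + z) = ip x y + ip x z" "ip x (r *\<^sub>R y) = r * ip x y"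
    by (metis sym add) (metis sym scale)
  have diff: "ip (x - y) z = ip x z - ip y z" for x y z
    using add[of "x - y" y z] by simp
  show "ip (x - y) z = ip x z - ip y z" "ip x (y - z) = ip x y - ip x z"
    by (fact diff) (metis sym diff)
  show "ip x x = 0 \<longleftrightarrow> x = 0"
    using assms by (auto simp: real_inner_product_def)
qed

text \<open>\<open>R\<close> is the orthogonal reflection in the hyperplane through the midpoint
  \<open>m\<close> with normal \<open>w\<close>; the points equidistant from \<open>a\<close> and
  \<open>b\<close> lie on that hyperplane. If \<open>a = b\<close>, then \<open>w = 0\<close> and
  \<open>R\<close> is the identity.\<close>

lemma bisector_reflection:
  fixes ip :: "'a::real_normed_vector \<Rightarrow> 'a \<Rightarrow> real"
  assumes ip: "real_inner_product ip" and norm: "\<And>f. (norm f)\<^sup>2 = ip f f"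
  obtains R :: "'a \<Rightarrow> 'a" where "\<And>x y. dist (R x) (R y) = dist x y" "surj R" "R a = b"
    "\<And>p. dist p a = dist p b \<Longrightarrow> R p = p"
proof -
  note ipD = real_inner_productD[OF ip]
  define w where "w = a - b"
  define m where "m = (1/2) *\<^sub>R (a + b)"
  define c where "c x = 2 * ip (x - m) w / ip w w" for x
  define R where "R x = x - c x *\<^sub>R w" for x
  have c_diff: "c x - c y = 2 * ip (x - y) w / ip w w" for x y
    by (simp add: c_def ipD diff_divide_distrib[symmetric] algebra_simps)
  have iso: "dist (R x) (R y) = dist x y" for x y
  proof -
    define d where "d = x - y"
    define k where "k = c x - c y"
    have "R x - R y = d - k *\<^sub>R w"
      by (simp add: R_def d_def k_def algebra_simps)
    \<comment> \<open>This identity, valid also for \<open>w = 0\<close>, makes the cross term and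
      the square term in the expansion of \<open>ip (d - k *\<^sub>R w) (d - k *\<^sub>R w)\<close>
      cancel.\<close>
    moreover have "k * ip w w = 2 * ip d w"
    proof (cases "w = 0")
      case True
      then show ?thesis
        using ipD(5)[of d 0 0] ipD(8)[of 0] by simp
    next
      case False
      then show ?thesis
        using ipD(8)[of w] by (simp add: k_def c_diff d_def)
    qed
    then have "ip (d - k *\<^sub>R w) (d - k *\<^sub>R w) = ip d d"
      using ipD(1)[of w d] by (simp add: ipD(3-7) algebra_simps)
    ultimately have "(norm (R x - R y))\<^sup>2 = (norm (x - y))\<^sup>2"
      by (simp add: norm d_def)
    then show ?thesis
      by (simp add: dist_norm)
  qed
  \<comment> \<open>The reflection flips the signed offset from the hyperplane, so it is an
    involution and hence onto.\<close>
  have c_R: "c (R x) = - c x" for x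
  proof (cases "w = 0")
    case True
    then show ?thesis
      using ipD(5)[of _ 0 0] ipD(8)[of 0] by (simp add: c_def)
  next
    case False
    have "c (R x) - c x = 2 * ip (- (c x *\<^sub>R w)) w / ip w w"
      unfolding c_diff by (simp add: R_def)
    also have "- (c x *\<^sub>R w) = (- c x) *\<^sub>R w"
      by simp
    also have "2 * ip ((- c x) *\<^sub>R w) w / ip w w = - 2 * c x"
      using False ipD(8)[of w] by (simp only: ipD(3)) simp
    finally show ?thesis
      by simp
  qed
  have "R (R x) = x" for x
    using c_R[of x] by (simp add: R_def[of "R x"]) (simp add: R_def)
  then have "surj R"
    by (metis surjI)
  moreover have "R a = b"
  proof (cases "w = 0")
    case True
    then show ?thesis
      by (simp add: R_def w_def)
  next
    case False
    have "a - m = (1/2) *\<^sub>R w"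
      using scaleR_half_double[of a] by (simp add: m_def w_def algebra_simps)
    then have "c a = 1"
      using False ipD(8)[of w] by (simp add: c_def ipD(3))
    then show ?thesis
      by (simp add: R_def w_def)
  qed
  moreover have "R p = p" if "dist p a = dist p b" for p
  proof -
    \<comment> \<open>The difference of the two sides is \<open>- 2 * ip (p - m) w\<close>.\<close>
    have "ip (p - a) (p - a) = ip (p - b) (p - b)"
      using that by (simp add: dist_norm flip: norm)
    then have "ip (p - m) w = 0"
      using ipD(1)[of a b] ipD(1)[of p a] ipD(1)[of p b]
      by (simp add: m_def w_def ipD(2-7) algebra_simps)
    then show ?thesis
      by (simp add: R_def c_def)
  qed
  ultimately show ?thesis
    using iso that by blast
qed

lemma finite_isometry_extends:
  fixes ip :: "'a::real_normed_vector \<Rightarrow> 'a \<Rightarrow> real"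
  assumes ip: "real_inner_product ip" and norm: "\<And>f. (norm f)\<^sup>2 = ip f f"
    and "finite Y" and "\<forall>x\<in>Y. \<forall>y\<in>Y. dist (T x) (T y) = dist x y"
  shows "\<exists>S::'a\<Rightarrow>'a. (\<forall>x y. dist (S x) (S y) = dist x y) \<and> surj S \<and> (\<forall>y\<in>Y. S y = T y)"
  using assms(3,4)
proof (induction Y)
  case empty
  show ?case
    by (rule exI[of _ id]) simp
next
  case (insert y F)
  then obtain S where S: "\<And>x y. dist (S x) (S y) = dist x y" "surj S" "\<And>y. y \<in> F \<Longrightarrow> S y = T y"
    by fastforce
  obtain R where R: "\<And>x y. dist (R x) (R y) = dist x y" "surj R" "R (S y) = T y"
      "\<And>p. dist p (S y) = dist p (T y) \<Longrightarrow> R p = p"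
    using bisector_reflection[OF ip norm, of "S y" "T y"] by metis
  \<comment> \<open>On \<open>F\<close> the maps \<open>S\<close> and \<open>T\<close> agree, so
    \<open>T p\<close> has distance \<open>dist p y\<close> to both \<open>S y\<close> and
    \<open>T y\<close> and is fixed by \<open>R\<close>.\<close>
  have "R (S p) = T p" if "p \<in> F" for p
  proof -
    have "dist (T p) (S y) = dist (T p) (T y)"
      using that S(1)[of p y] S(3)[of p] insert.prems by simp
    then show ?thesis
      using R(4) S(3) that by simp
  qed
  moreover have "surj (R \<circ> S)"
    using S(2) R(2) by (rule comp_surj)
  ultimately show ?case
    using R(1,3) S(1) by (intro exI[of _ "R \<circ> S"]) simp
qed

lemma inner_product_imp_homogeneous:
  fixes ip :: "'a::real_normed_vector \<Rightarrow> 'a \<Rightarrow> real"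
  assumes "real_inner_product ip" and "\<And>f. (norm f)\<^sup>2 = ip f f"
  shows "strongly_point_homogeneous n (UNIV :: 'a set)"
  unfolding strongly_point_homogeneous_def
proof (intro allI impI)
  fix Y Y' :: "'a set" and T
  assume Y: "Y \<subseteq> UNIV \<and> Y' \<subseteq> UNIV \<and> finite Y \<and> finite Y' \<and> card Y = card Y' \<and> card Y \<le> n
    \<and> isometry_between Y Y' T"
  then obtain S where "\<forall>x y. dist (S x) (S y) = dist x y" "surj S" "\<forall>y\<in>Y. S y = T y"
    using finite_isometry_extends[OF assms, of Y T] by (auto simp: isometry_between_def)
  then show "\<exists>S. isometry_between UNIV UNIV S \<and> range S = UNIV \<and> (\<forall>y\<in>Y. S y = T y)"
    by (auto simp: isometry_between_def)
qed

section \<open>The Mazur--Ulam theorem\<close>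

lemma isometry_inv_into:
  assumes iso: "\<And>x y. dist (f x) (f y) = dist x y" and "surj f"
  shows "f (inv f y) = y" "inv f (f x) = x" "dist (inv f y) (inv f z) = dist y z"
proof -
  have "inj f"
    by (metis injI iso dist_eq_0_iff)
  then show f: "f (inv f y) = y" "inv f (f x) = x" for x y
    using \<open>surj f\<close> by (simp_all add: surj_f_inv_f)
  show "dist (inv f y) (inv f z) = dist y z"
    using iso[of "inv f y" "inv f z"] f by simp
qed

text \<open>
  Vaisala's argument: composing with the point reflection \<open>\<psi>\<close> at the midpoint doubles the
  displacement of the midpoint, which is bounded over all isometries fixing both endpoints.
\<close>

lemma isometry_fixing_endpoints_fixes_midpoint:
  fixes g :: "'a::real_normed_vector \<Rightarrow> 'a"
  assumes "\<And>x y. dist (g x) (g y) = dist x y" "surj g" "g a = a" "g b = b"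
  shows "g (midpoint a b) = midpoint a b"
proof -
  define z where "z = midpoint a b"
  define W where "W = {g::'a\<Rightarrow>'a. (\<forall>x y. dist (g x) (g y) = dist x y) \<and> surj g \<and> g a = a \<and> g b = b}"
  define \<psi> where "\<psi> x = 2 *\<^sub>R z - x" for x
  have ab: "\<psi> a = b" "\<psi> b = a"
    by (simp_all add: \<psi>_def z_def midpoint_def algebra_simps)
  have \<psi>: "\<psi> (\<psi> x) = x" "dist (\<psi> x) (\<psi> y) = dist x y" "\<psi> z = z" for x y
    by (simp_all add: \<psi>_def dist_norm norm_minus_commute scaleR_2)
  have double: "\<exists>g'\<in>W. dist (g' z) z = 2 * dist (g z) z" if "g \<in> W" for g
  proof -
    have g: "\<And>x y. dist (g x) (g y) = dist x y" "surj g" "g a = a" "g b = b"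
      using that by (auto simp: W_def)
    note inv = isometry_inv_into[OF g(1,2)]
    \<comment> \<open>As \<open>\<psi>\<close> exchanges \<open>a\<close> and \<open>b\<close>, this
      commutator of \<open>g\<close> and \<open>\<psi>\<close> again fixes both endpoints.\<close>
    define g' where "g' x = \<psi> (inv g (\<psi> (g x)))" for x
    have "g' (inv g (\<psi> (g (\<psi> x)))) = x" for x
      by (simp add: g'_def inv \<psi>)
    then have "surj g'"
      by (rule surjI)
    moreover have "inv g a = a" "inv g b = b"
      by (metis inv(2) g(3)) (metis inv(2) g(4))
    ultimately have "g' \<in> W"
      by (simp add: W_def g'_def \<psi> inv g ab)
    \<comment> \<open>Apply the isometry \<open>\<psi>\<close>, which fixes \<open>z\<close>, and
      then \<open>g\<close> to both points.\<close>
    moreover have "dist (g' z) z = dist (\<psi> (g z)) (g z)"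
      by (metis \<psi>(2,3) g'_def inv(2,3))
    then have "dist (g' z) z = norm (2 *\<^sub>R (z - g z))"
      by (simp add: \<psi>_def dist_norm scaleR_2 algebra_simps)
    then have "dist (g' z) z = 2 * dist (g z) z"
      by (simp add: dist_norm norm_minus_commute)
    ultimately show ?thesis
      by blast
  qed
  have bound: "dist (g z) z \<le> 2 * dist a z" if "g \<in> W" for g
  proof -
    have "dist (g z) z \<le> dist (g z) (g a) + dist a z"
      using that by (auto simp: W_def intro: dist_triangle)
    also have "dist (g z) (g a) = dist a z"
      using that by (simp add: W_def) (metis dist_commute)
    finally show ?thesis
      by simp
  qed
  have "g \<in> W"
    using assms by (auto simp: W_def)
  have "\<exists>g'\<in>W. dist (g' z) z = 2 ^ n * dist (g z) z" for n
  proof (induction n)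
    case 0
    then show ?case
      using \<open>g \<in> W\<close> by auto
  next
    case (Suc n)
    then show ?case
      using double by (metis mult.assoc power_Suc)
  qed
  then have le: "2 ^ n * dist (g z) z \<le> 2 * dist a z" for n
    using bound by metis
  have "dist (g z) z = 0"
  proof (rule ccontr)
    assume "dist (g z) z \<noteq> 0"
    then have pos: "dist (g z) z > 0"
      by simp
    obtain n where "2 * dist a z / dist (g z) z < 2 ^ n"
      using real_arch_pow[of 2] by fastforce
    with pos le[of n] show False
      by (simp add: field_simps)
  qed
  then show ?thesis
    by (simp add: z_def)
qed

text \<open>Combining \<open>f\<close> with the point reflections \<open>\<psi>\<close> and
  \<open>\<psi>'\<close> at the two midpoints gives an isometry \<open>h\<close> of the domain that
  fixes \<open>a\<close> and \<open>b\<close>. It therefore fixes \<open>z\<close>, so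
  \<open>f z\<close> is a fixed point of \<open>\<psi>'\<close>, and the only such point is
  \<open>z'\<close>.\<close>

lemma surj_isometry_midpoint:
  fixes f :: "'a::real_normed_vector \<Rightarrow> 'b::real_normed_vector"
  assumes f: "\<And>x y. dist (f x) (f y) = dist x y" "surj f"
  shows "f (midpoint a b) = midpoint (f a) (f b)"
proof -
  note inv = isometry_inv_into[OF f]
  define z where "z = midpoint a b"
  define z' where "z' = midpoint (f a) (f b)"
  define \<psi> where "\<psi> x = 2 *\<^sub>R z - x" for x
  define \<psi>' where "\<psi>' x = 2 *\<^sub>R z' - x" for x
  have \<psi>: "\<psi> (\<psi> x) = x" "dist (\<psi> x) (\<psi> y) = dist x y" "\<psi> z = z" for x y
    by (simp_all add: \<psi>_def dist_norm norm_minus_commute scaleR_2)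
  have \<psi>': "\<psi>' (\<psi>' x) = x" "dist (\<psi>' x) (\<psi>' y) = dist x y" for x y
    by (simp_all add: \<psi>'_def dist_norm norm_minus_commute)
  have ends: "\<psi> a = b" "\<psi> b = a" "\<psi>' (f a) = f b" "\<psi>' (f b) = f a"
    by (simp_all add: \<psi>_def \<psi>'_def z_def z'_def midpoint_def algebra_simps)
  define h where "h x = \<psi> (inv f (\<psi>' (f x)))" for x
  have "h (inv f (\<psi>' (f (\<psi> x)))) = x" for x
    by (simp add: h_def inv \<psi> \<psi>')
  then have "surj h"
    by (rule surjI)
  then have "h z = z"
    unfolding z_def
    by (intro isometry_fixing_endpoints_fixes_midpoint) (simp_all add: h_def inv \<psi> \<psi>' f ends)
  then have "\<psi>' (f z) = f z"
    by (metis \<psi>(1,3) h_def inv(1))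
  then have "2 *\<^sub>R z' = 2 *\<^sub>R f z"
    by (simp add: \<psi>'_def algebra_simps scaleR_2)
  then show ?thesis
    by (simp add: z_def z'_def)
qed

text \<open>Preservation of midpoints together with \<open>f 0 = 0\<close> gives additivity, hence
  homogeneity for integers. Real scalars follow by a boundedness argument.\<close>

theorem mazur_ulam:
  fixes f :: "'a::real_normed_vector \<Rightarrow> 'b::real_normed_vector"
  assumes f: "\<And>x y. dist (f x) (f y) = dist x y" "surj f" and "f 0 = 0"
  shows "linear f"
proof -
  have mid: "midpoint x y = (1/2) *\<^sub>R (x + y)" for x y :: "'c::real_vector"
    by (simp add: midpoint_def)
  have half: "f ((1/2) *\<^sub>R x) = (1/2) *\<^sub>R f x" for x
    using surj_isometry_midpoint[OF f, of 0 x] \<open>f 0 = 0\<close> unfolding mid by simp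
  have add: "f (x + y) = f x + f y" for x y
    using surj_isometry_midpoint[OF f, of x y] unfolding mid half by simp
  have minus: "f (- x) = - f x" for x
    using add[of x "- x"] \<open>f 0 = 0\<close> by (simp add: eq_neg_iff_add_eq_0 add.commute)
  have nat: "f (real n *\<^sub>R x) = real n *\<^sub>R f x" for n x
    by (induction n) (simp_all add: \<open>f 0 = 0\<close> add scaleR_left_distrib)
  have int: "f (of_int m *\<^sub>R x) = of_int m *\<^sub>R f x" for m x
    by (cases m) (simp_all add: nat minus flip: of_nat_Suc)
  have norm: "norm (f x) = norm x" for x
    using f(1)[of x 0] \<open>f 0 = 0\<close> by (simp add: dist_norm)
  have scale: "f (r *\<^sub>R x) = r *\<^sub>R f x" for r x
  proof -
    \<comment> \<open>By additivity, \<open>n\<close> times the defect at \<open>r\<close> is the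
      defect at \<open>n * r\<close>. Removing the integer part leaves a scalar of modulus at most
      1, which bounds the defect independently of \<open>n\<close>.\<close>
    have le: "real n * norm (f (r *\<^sub>R x) - r *\<^sub>R f x) \<le> 2 * norm x" for n
    proof -
      define t where "t = real n * r"
      define m where "m = \<lfloor>t\<rfloor>"
      have tm: "\<bar>t - m\<bar> \<le> 1"
        unfolding m_def by linarith
      have "t *\<^sub>R x = of_int m *\<^sub>R x + (t - m) *\<^sub>R x"
        by (simp add: algebra_simps)
      then have "f (t *\<^sub>R x) - t *\<^sub>R f x = f ((t - m) *\<^sub>R x) - (t - m) *\<^sub>R f x"
        by (simp only: add int) (simp add: algebra_simps)
      then have "norm (f (t *\<^sub>R x) - t *\<^sub>R f x) \<le> \<bar>t - m\<bar> * norm x + \<bar>t - m\<bar> * norm x"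
        using norm_triangle_ineq4[of "f ((t - m) *\<^sub>R x)" "(t - m) *\<^sub>R f x"] by (simp add: norm)
      also have "\<dots> \<le> 2 * norm x"
        using mult_right_mono[OF tm, of "norm x"] by (simp add: mult.commute)
      also have "f (t *\<^sub>R x) - t *\<^sub>R f x = real n *\<^sub>R (f (r *\<^sub>R x) - r *\<^sub>R f x)"
        using nat[of n "r *\<^sub>R x"] by (simp add: t_def scaleR_right_diff_distrib)
      finally show ?thesis
        by simp
    qed
    have "norm (f (r *\<^sub>R x) - r *\<^sub>R f x) = 0"
    proof (rule ccontr)
      assume "norm (f (r *\<^sub>R x) - r *\<^sub>R f x) \<noteq> 0"
      then have "norm (f (r *\<^sub>R x) - r *\<^sub>R f x) > 0"
        by simp
      then obtain n :: nat where "2 * norm x < real n * norm (f (r *\<^sub>R x) - r *\<^sub>R f x)"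
        using reals_Archimedean3 by blast
      with le[of n] show False
        by simp
    qed
    then show ?thesis
      by simp
  qed
  show ?thesis
    using add scale by (rule linearI)
qed

section \<open>Ficken's characterization of inner product norms\<close>

definition ficken :: "'a::real_normed_vector itself \<Rightarrow> bool"
  where "ficken _ \<longleftrightarrow>
    (\<forall>(x::'a) y a b. norm x = norm y \<longrightarrow> norm (a *\<^sub>R x + b *\<^sub>R y) = norm (b *\<^sub>R x + a *\<^sub>R y))"

lemma fickenD:
  fixes x y :: "'a::real_normed_vector"
  assumes "ficken TYPE('a)" "norm x = norm y"
  shows "norm (a *\<^sub>R x + b *\<^sub>R y) = norm (b *\<^sub>R x + a *\<^sub>R y)"
  using assms by (auto simp: ficken_def)

lemma homogeneous_imp_ficken:
  assumes "strongly_point_homogeneous n (UNIV :: 'a::real_normed_vector set)" "3 \<le> n"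
  shows "ficken TYPE('a)"
  unfolding ficken_def
proof (intro allI impI)
  fix x y :: 'a and a b :: real
  assume xy: "norm x = norm y"
  define T where "T p = (if p = x then y else if p = y then x else p)" for p
  have "card {0, x, y} \<le> n"
    using \<open>3 \<le> n\<close> card_insert_le_m1[of 3 "{x, y}" 0] card_insert_le_m1[of 2 "{y}" x] by simp
  \<comment> \<open>The origin stays fixed even if \<open>x\<close> or \<open>y\<close> is
    \<open>0\<close>, because equal norms then force both to vanish.\<close>
  moreover have T: "T 0 = 0" "T x = y" "T y = x"
    using xy by (auto simp: T_def)
  then have "isometry_between {0, x, y} {0, x, y} T"
    using xy by (simp add: isometry_between_def dist_norm norm_minus_commute[of x y])
  ultimately obtain S where "isometry_between UNIV UNIV S" "surj S" "\<forall>p\<in>{0, x, y}. S p = T p"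
    using assms(1)[unfolded strongly_point_homogeneous_def, rule_format, of "{0, x, y}" "{0, x, y}" T]
    by blast
  then have S: "\<And>p q. dist (S p) (S q) = dist p q" "surj S" "S 0 = 0" "S x = y" "S y = x"
    using T by (simp_all add: isometry_between_def)
  have "linear S"
    using S(1-3) by (rule mazur_ulam)
  have "norm (a *\<^sub>R x + b *\<^sub>R y) = norm (S (a *\<^sub>R x + b *\<^sub>R y))"
    using S(1)[of _ 0] S(3) by (simp add: dist_norm)
  also have "S (a *\<^sub>R x + b *\<^sub>R y) = b *\<^sub>R x + a *\<^sub>R y"
    using \<open>linear S\<close> S(4,5) by (simp add: linear_add linear_scale add.commute)
  finally show "norm (a *\<^sub>R x + b *\<^sub>R y) = norm (b *\<^sub>R x + a *\<^sub>R y)" .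
qed

section \<open>Planes in a space satisfying Ficken's condition\<close>

text \<open>Ficken's condition applied to the vectors \<open>u + v\<close> and \<open>u - v\<close>
  of equal norm: exchanging the coefficients \<open>(s + t)/2\<close> and \<open>(s - t)/2\<close>
  changes the sign of \<open>t\<close>.\<close>

lemma ficken_isosceles:
  fixes u v :: "'a::real_normed_vector"
  assumes "ficken TYPE('a)" "norm (u + v) = norm (u - v)"
  shows "norm (s *\<^sub>R u + t *\<^sub>R v) = norm (s *\<^sub>R u - t *\<^sub>R v)"
proof -
  have "((s + t)/2) *\<^sub>R (u + v) + ((s - t)/2) *\<^sub>R (u - v)
      = ((s + t)/2 + (s - t)/2) *\<^sub>R u + ((s + t)/2 - (s - t)/2) *\<^sub>R v"
    "((s - t)/2) *\<^sub>R (u + v) + ((s + t)/2) *\<^sub>R (u - v)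
      = ((s + t)/2 + (s - t)/2) *\<^sub>R u - ((s + t)/2 - (s - t)/2) *\<^sub>R v"
    by (simp_all only: scaleR_add_left scaleR_diff_left scaleR_add_right scaleR_diff_right)
      (simp_all add: algebra_simps)
  moreover have "(s + t)/2 + (s - t)/2 = s" "(s + t)/2 - (s - t)/2 = t"
    by (simp_all add: field_simps)
  ultimately show ?thesis
    using fickenD[OF assms, of "(s + t)/2" "(s - t)/2"] by simp
qed

text \<open>The vectors \<open>u\<close> and \<open>a *\<^sub>R u + b *\<^sub>R w\<close> are mirror
  images in the line spanned by \<open>p\<close>, and \<open>ficken_isosceles\<close> for
  \<open>p\<close> and \<open>q\<close> shows that this reflection preserves the norm. For
  \<open>a = -1\<close> the vector \<open>p\<close> would vanish, but then
  \<open>b = 0\<close>.\<close>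

lemma ficken_unit_circle:
  fixes u w :: "'a::real_normed_vector"
  assumes F: "ficken TYPE('a)" and "norm u = 1" "norm w = 1" "norm (u + w) = norm (u - w)"
    and ab: "a\<^sup>2 + b\<^sup>2 = 1"
  shows "norm (a *\<^sub>R u + b *\<^sub>R w) = 1"
proof (cases "a = -1")
  case True
  then show ?thesis
    using assms by simp
next
  case False
  \<comment> \<open>\<open>p\<close> spans the axis of the Euclidean reflection exchanging \<open>u\<close> and \<open>a u + b w\<close>,
    and \<open>q\<close> is \<open>p\<close> turned by a right angle.\<close>
  define p where "p = (1 + a) *\<^sub>R u + b *\<^sub>R w"
  define q where "q = (- b) *\<^sub>R u + (1 + a) *\<^sub>R w"
  have "norm (p + q) = norm ((1 + a - b) *\<^sub>R u + (1 + a + b) *\<^sub>R w)"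
    by (simp add: p_def q_def algebra_simps)
  \<comment> \<open>The norm is invariant under exchanging \<open>u\<close> and \<open>w\<close>
    and, in the next step, under changing the sign of \<open>w\<close>; together these carry
    \<open>p + q\<close> to \<open>p - q\<close>.\<close>
  also have "\<dots> = norm ((1 + a + b) *\<^sub>R u + (1 + a - b) *\<^sub>R w)"
    using F assms(2,3) by (simp add: fickenD)
  also have "\<dots> = norm ((1 + a + b) *\<^sub>R u - (1 + a - b) *\<^sub>R w)"
    using F assms(4) by (rule ficken_isosceles)
  also have "\<dots> = norm (p - q)"
    by (simp add: p_def q_def algebra_simps)
  finally have pq: "norm (p + q) = norm (p - q)" .
  \<comment> \<open>Chosen to cancel the \<open>w\<close>-coefficient of
    \<open>(1/2) *\<^sub>R p + t *\<^sub>R q\<close>.\<close>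
  define t where "t = - b / (2 * (1 + a))"
  have t: "(1 + a) * t = - b / 2"
    using False by (simp add: t_def field_simps)
  have b2: "b * b = (1 + a) * (1 - a)"
    using ab by (simp add: power2_eq_square algebra_simps)
  have "(1 + a) * (b * t) = (1 + a) * (- (1 - a) / 2)"
    using t b2 by (metis mult.left_commute mult_minus_right times_divide_eq_right)
  then have bt: "b * t = - (1 - a) / 2"
    using False by simp
  have "(1/2) *\<^sub>R p + t *\<^sub>R q = ((1 + a)/2 - b * t) *\<^sub>R u + (b/2 + (1 + a) * t) *\<^sub>R w"
    "(1/2) *\<^sub>R p - t *\<^sub>R q = ((1 + a)/2 + b * t) *\<^sub>R u + (b/2 - (1 + a) * t) *\<^sub>R w"
    by (simp_all add: p_def q_def algebra_simps add_divide_distrib)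
  moreover have "(1 + a)/2 - - (1 - a)/2 = 1" "b/2 + - b/2 = 0"
    "(1 + a)/2 + - (1 - a)/2 = a" "b/2 - - b/2 = b"
    by (simp_all add: field_simps)
  ultimately have "(1/2) *\<^sub>R p + t *\<^sub>R q = u" "(1/2) *\<^sub>R p - t *\<^sub>R q = a *\<^sub>R u + b *\<^sub>R w"
    by (simp_all only: t bt scaleR_zero_left scaleR_one add_0_right)
  then show ?thesis
    using ficken_isosceles[OF F pq, of "1/2" t] assms(2) by simp
qed

lemma ficken_pythagoras_unit:
  fixes u w :: "'a::real_normed_vector"
  assumes "ficken TYPE('a)" "norm u = 1" "norm w = 1" "norm (u + w) = norm (u - w)"
  shows "(norm (a *\<^sub>R u + b *\<^sub>R w))\<^sup>2 = a\<^sup>2 + b\<^sup>2"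
proof (cases "a = 0 \<and> b = 0")
  case True
  then show ?thesis
    by simp
next
  case False
  define r where "r = sqrt (a\<^sup>2 + b\<^sup>2)"
  have r2: "r\<^sup>2 = a\<^sup>2 + b\<^sup>2"
    by (simp add: r_def)
  then have "r \<noteq> 0"
    using False by (metis sum_power2_eq_zero_iff zero_eq_power2)
  have "(a/r)\<^sup>2 + (b/r)\<^sup>2 = 1"
    using \<open>r \<noteq> 0\<close> by (simp add: power_divide flip: add_divide_distrib r2)
  then have 1: "norm ((a/r) *\<^sub>R u + (b/r) *\<^sub>R w) = 1"
    using assms by (intro ficken_unit_circle)
  have "a *\<^sub>R u + b *\<^sub>R w = r *\<^sub>R ((a/r) *\<^sub>R u + (b/r) *\<^sub>R w)"
    using \<open>r \<noteq> 0\<close> by (simp add: scaleR_add_right)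
  then show ?thesis
    using 1 r2 by (simp add: power_mult_distrib)
qed

lemma ficken_pythagoras:
  fixes x v :: "'a::real_normed_vector"
  assumes F: "ficken TYPE('a)" and orth: "norm (v + d *\<^sub>R x) = norm (v - d *\<^sub>R x)" "d \<noteq> 0"
  shows "(norm (s *\<^sub>R x + t *\<^sub>R v))\<^sup>2 = s\<^sup>2 * (norm x)\<^sup>2 + t\<^sup>2 * (norm v)\<^sup>2"
proof (cases "x = 0 \<or> v = 0")
  case True
  then show ?thesis
    by (auto simp: power_mult_distrib)
next
  case False
  define u where "u = x /\<^sub>R norm x"
  define w where "w = v /\<^sub>R norm v"
  have uw: "norm u = 1" "norm w = 1" "x = norm x *\<^sub>R u" "v = norm v *\<^sub>R w"
    using False by (simp_all add: u_def w_def)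
  \<comment> \<open>Orthogonality in the isosceles sense survives rescaling: the chosen coefficients
    turn \<open>v\<close> and \<open>d *\<^sub>R x\<close> into the unit vectors \<open>w\<close>
    and \<open>u\<close>.\<close>
  have "norm (w + u) = norm (w - u)"
    using ficken_isosceles[OF F orth(1), of "inverse (norm v)" "inverse (norm x) / d"] \<open>d \<noteq> 0\<close>
    by (simp add: u_def w_def)
  then have "norm (u + w) = norm (u - w)"
    by (simp add: add.commute norm_minus_commute)
  from ficken_pythagoras_unit[OF F uw(1,2) this, of "s * norm x" "t * norm v"]
  show ?thesis
    using uw(3,4) by (simp add: power_mult_distrib flip: scaleR_scaleR)
qed

text \<open>Along the line the norm is continuous and unbounded in both directions, so the
  intermediate value theorem applies. The midpoint of the two points found will serve as the foot of
  a perpendicular.\<close>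

lemma equal_norms_on_line:
  fixes x y :: "'a::real_normed_vector"
  assumes "x \<noteq> 0"
  obtains a c where "a \<noteq> c" "norm (y + a *\<^sub>R x) = norm (y + c *\<^sub>R x)"
proof -
  define g where "g a = norm (y + a *\<^sub>R x)" for a
  have cont: "continuous_on S g" for S
    unfolding g_def by (intro continuous_intros)
  have big: "g a \<ge> M" if "\<bar>a\<bar> \<ge> (M + norm y) / norm x" for a M
  proof -
    have "M + norm y \<le> \<bar>a\<bar> * norm x"
      using that \<open>x \<noteq> 0\<close> by (simp add: field_simps)
    also have "\<dots> \<le> g a + norm y"
      using norm_triangle_ineq4[of "y + a *\<^sub>R x" y] by (simp add: g_def)
    finally show ?thesis
      by simp
  qed
  have "\<exists>a c. a \<noteq> c \<and> g a = g c"
  \<comment> \<open>The larger of \<open>g 0\<close> and \<open>g 1\<close> is attained again beyond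
    the other parameter, which keeps the two parameters distinct.\<close>
  proof (cases "g 0 \<le> g 1")
    case True
    define R where "R = - \<bar>(g 1 + norm y) / norm x\<bar>"
    have "g R \<ge> g 1"
      by (rule big) (unfold R_def, linarith)
    then obtain a where "R \<le> a" "a \<le> 0" "g a = g 1"
      using IVT2'[of g 0 "g 1" R] True cont by (auto simp: R_def)
    then show ?thesis
      by (intro exI[of _ a] exI[of _ 1]) auto
  next
    case False
    define R where "R = 1 + \<bar>(g 0 + norm y) / norm x\<bar>"
    have "g R \<ge> g 0"
      by (rule big) (unfold R_def, linarith)
    then obtain a where "1 \<le> a" "a \<le> R" "g a = g 0"
      using IVT'[of g 1 "g 0" R] False cont by (auto simp: R_def)
    then show ?thesis
      by (intro exI[of _ a] exI[of _ 0]) auto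
  qed
  then show ?thesis
    using that by (auto simp: g_def)
qed

text \<open>If \<open>y + a *\<^sub>R x\<close> and \<open>y + c *\<^sub>R x\<close> have equal
  norm, their midpoint \<open>v\<close> is orthogonal to \<open>x\<close>. Rewriting
  \<open>s *\<^sub>R x + t *\<^sub>R y\<close> as
  \<open>(s - t * k) *\<^sub>R x + t *\<^sub>R v\<close> and using Pythagoras yields the quadratic
  form, with \<open>B = - k * (norm x)\<^sup>2\<close>.\<close>

lemma ficken_quadratic:
  fixes x y :: "'a::real_normed_vector"
  assumes F: "ficken TYPE('a)"
  obtains B where "\<And>s t. (norm (s *\<^sub>R x + t *\<^sub>R y))\<^sup>2 = s\<^sup>2 * (norm x)\<^sup>2 + 2 * s * t * B + t\<^sup>2 * (norm y)\<^sup>2"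
proof (cases "x = 0")
  case True
  then show ?thesis
    using that[of 0] by (simp add: power_mult_distrib)
next
  case False
  then obtain a c where ac: "a \<noteq> c" "norm (y + a *\<^sub>R x) = norm (y + c *\<^sub>R x)"
    by (rule equal_norms_on_line)
  define k where "k = (a + c)/2"
  define d where "d = (a - c)/2"
  define v where "v = y + k *\<^sub>R x"
  have kd: "k + d = a" "k - d = c"
    by (simp_all add: k_def d_def field_simps)
  have "v + d *\<^sub>R x = y + (k + d) *\<^sub>R x" "v - d *\<^sub>R x = y + (k - d) *\<^sub>R x"
    by (simp_all add: v_def algebra_simps)
  then have "norm (v + d *\<^sub>R x) = norm (v - d *\<^sub>R x)"
    using ac(2) kd by simp
  moreover have "d \<noteq> 0"
    using ac(1) by (simp add: d_def)
  ultimately have pyth: "(norm (s *\<^sub>R x + t *\<^sub>R v))\<^sup>2 = s\<^sup>2 * (norm x)\<^sup>2 + t\<^sup>2 * (norm v)\<^sup>2" for s t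
    by (rule ficken_pythagoras[OF F])
  have form: "(norm (s *\<^sub>R x + t *\<^sub>R y))\<^sup>2 = (s - t * k)\<^sup>2 * (norm x)\<^sup>2 + t\<^sup>2 * (norm v)\<^sup>2" for s t
    using pyth[of "s - t * k" t] by (simp add: v_def algebra_simps)
  have "(norm y)\<^sup>2 = k\<^sup>2 * (norm x)\<^sup>2 + (norm v)\<^sup>2"
    using form[of 0 1] by simp
  then show ?thesis
    by (intro that[of "- k * (norm x)\<^sup>2"], unfold form) (simp add: power2_eq_square algebra_simps)
qed

section \<open>Polarization and the real inner product\<close>

definition polar :: "'a::real_normed_vector \<Rightarrow> 'a \<Rightarrow> real"
  where "polar x y = ((norm (x + y))\<^sup>2 - (norm (x - y))\<^sup>2) / 4"

lemma polar_self: "polar x x = (norm x)\<^sup>2"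
  by (simp add: polar_def flip: scaleR_2)

text \<open>On the plane of \<open>x\<close> and \<open>y\<close> the polar form is read off from
  the mixed coefficient of the quadratic form, which gives homogeneity for all real scalars at
  once.\<close>

lemma ficken_polar_scale:
  fixes x y :: "'a::real_normed_vector"
  assumes F: "ficken TYPE('a)"
  shows "polar (r *\<^sub>R x) y = r * polar x y"
proof -
  obtain B where B: "\<And>s t. (norm (s *\<^sub>R x + t *\<^sub>R y))\<^sup>2
      = s\<^sup>2 * (norm x)\<^sup>2 + 2 * s * t * B + t\<^sup>2 * (norm y)\<^sup>2"
    using ficken_quadratic[OF F] by blast
  have "polar (s *\<^sub>R x) y = s * B" for s
    using B[of s 1] B[of s "-1"] by (simp add: polar_def)
  from this[of r] this[of 1] show ?thesis
    by simp
qed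

lemma ficken_parallelogram:
  fixes x y :: "'a::real_normed_vector"
  assumes F: "ficken TYPE('a)"
  shows "(norm (x + y))\<^sup>2 + (norm (x - y))\<^sup>2 = 2 * (norm x)\<^sup>2 + 2 * (norm y)\<^sup>2"
proof -
  obtain B where B: "\<And>s t. (norm (s *\<^sub>R x + t *\<^sub>R y))\<^sup>2
      = s\<^sup>2 * (norm x)\<^sup>2 + 2 * s * t * B + t\<^sup>2 * (norm y)\<^sup>2"
    using ficken_quadratic[OF F] by blast
  show ?thesis
    using B[of 1 1] B[of 1 "-1"] by simp
qed

text \<open>The argument of Jordan and von Neumann: in the alternating sum of four parallelogram
  laws, the terms with exactly one of \<open>x\<close> and \<open>y\<close> negated cancel.\<close>

lemma ficken_polar_add:
  fixes x y z :: "'a::real_normed_vector"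
  assumes F: "ficken TYPE('a)"
  shows "polar (x + y) z = polar x z + polar y z"
proof -
  note P = ficken_parallelogram[OF F]
  have "x + z + y = x + y + z" "y + z + x = x + y + z" "x - z + y = x + y - z" "y - z + x = x + y - z"
    by (simp_all add: algebra_simps)
  moreover have "norm (y + z - x) = norm (x - z - y)" "norm (y - z - x) = norm (x + z - y)"
    using norm_minus_commute[of "y + z" x] norm_minus_commute[of "y - z" x]
    by (simp_all add: algebra_simps)
  ultimately show ?thesis
    using P[of "x + z" y] P[of "x - z" y] P[of "y + z" x] P[of "y - z" x]
    by (simp add: polar_def field_simps)
qed

lemma ficken_polar_inner_product:
  assumes "ficken TYPE('a::real_normed_vector)"
  shows "real_inner_product (polar :: 'a \<Rightarrow> 'a \<Rightarrow> real)"
proof -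
  have "polar x y = polar y x" for x y :: 'a
    unfolding polar_def using add.commute[of x y] norm_minus_commute[of x y] by presburger
  then show ?thesis
    unfolding real_inner_product_def
    by (intro conjI allI ficken_polar_add[OF assms] ficken_polar_scale[OF assms])
      (simp_all add: polar_self)
qed

section \<open>Complex scalars\<close>

text \<open>Homogeneity concerns only the metric, so the real part, which gives the same squared
  norm, reduces the complex case to the real one.\<close>

lemma complex_inner_product_Re:
  fixes ip :: "'a::complex_normed_vector \<Rightarrow> 'a \<Rightarrow> complex"
  assumes ip: "complex_inner_product ip"
  shows "real_inner_product (\<lambda>x y. Re (ip x y))"
proof -
  have C: "ip x y = cnj (ip y x)" "ip (x + y) z = ip x z + ip y z" "ip (c *\<^sub>C x) y = c * ip x y"
    "ip x x \<in> \<real>" "0 \<le> Re (ip x x)" "ip x x = 0 \<longleftrightarrow> x = 0" for x y z c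
    using ip unfolding complex_inner_product_def by blast+
  have "Re (ip x y) = Re (ip y x)" for x y
    by (subst C(1)) simp
  moreover have "Re (ip x x) = 0 \<longleftrightarrow> x = 0" for x
    using C(4)[of x] C(6)[of x] by (auto simp: complex_is_Real_iff complex_eq_iff)
  ultimately show ?thesis
    unfolding real_inner_product_def using C(5) by (auto simp: C(2,3) scaleR_scaleC)
qed

text \<open>The imaginary part is forced: conjugate-linearity in the second argument makes
  \<open>Im\<close> of the form at \<open>(x, y)\<close> equal to \<open>Re\<close> at
  \<open>(x, \<i> *\<^sub>C y)\<close>. Invariance under \<open>\<i>\<close> makes multiplication by
  \<open>\<i>\<close> skew for \<open>ip\<close>, whence conjugate symmetry.\<close>

lemma complexify_inner_product:
  fixes ip :: "'a::complex_normed_vector \<Rightarrow> 'a \<Rightarrow> real"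
  assumes ip: "real_inner_product ip" and inv: "\<And>x y. ip (\<i> *\<^sub>C x) (\<i> *\<^sub>C y) = ip x y"
  shows "complex_inner_product (\<lambda>x y. Complex (ip x y) (ip x (\<i> *\<^sub>C y)))"
proof -
  note ipD = real_inner_productD[OF ip]
  have ii: "\<i> *\<^sub>C \<i> *\<^sub>C x = (-1) *\<^sub>R x" for x :: 'a
    by (simp only: scaleC_scaleC scaleR_scaleC) simp
  have skew: "ip (\<i> *\<^sub>C x) y = - ip x (\<i> *\<^sub>C y)" for x y
    using inv[of "\<i> *\<^sub>C x" y] by (simp only: ii ipD(3))
  have self: "ip x (\<i> *\<^sub>C x) = 0" for x
    using skew[of x x] ipD(1)[of x "\<i> *\<^sub>C x"] by simp
  have cart: "c *\<^sub>C x = Re c *\<^sub>R x + Im c *\<^sub>R (\<i> *\<^sub>C x)" for c and x :: 'a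
  proof -
    have "c *\<^sub>C x = (of_real (Re c) + of_real (Im c) * \<i>) *\<^sub>C x"
      by (metis complex_eq mult.commute)
    then show ?thesis
      by (simp add: scaleR_scaleC scaleC_add_left scaleC_scaleC)
  qed
  have split: "ip (c *\<^sub>C x) y = Re c * ip x y - Im c * ip x (\<i> *\<^sub>C y)" for c x y
    by (subst cart) (simp only: ipD(2,3) skew)
  have scale: "Complex (ip (c *\<^sub>C x) y) (ip (c *\<^sub>C x) (\<i> *\<^sub>C y)) = c * Complex (ip x y) (ip x (\<i> *\<^sub>C y))"
    for c x y
  proof -
    have "ip x (\<i> *\<^sub>C \<i> *\<^sub>C y) = - ip x y"
      using inv[of x y] skew[of x "\<i> *\<^sub>C y"] by simp
    then show ?thesis
      by (simp add: split complex_eq_iff)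
  qed
  have conj: "Complex (ip x y) (ip x (\<i> *\<^sub>C y)) = cnj (Complex (ip y x) (ip y (\<i> *\<^sub>C x)))" for x y
    using skew[of x y] ipD(1)[of y "\<i> *\<^sub>C x"] ipD(1)[of x y] by (simp add: complex_eq_iff)
  have "0 \<le> ip x x" for x
    using ip by (simp add: real_inner_product_def)
  then show ?thesis
    unfolding complex_inner_product_def
    by (intro conjI allI conj scale) (simp_all add: complex_eq_iff complex_is_Real_iff self ipD(2,8))
qed

text \<open>Multiplication by \<open>\<i>\<close> is additive and preserves norms; this supplies the
  invariance hypothesis of \<open>complexify_inner_product\<close>.\<close>

lemma polar_ii:
  fixes x y :: "'a::complex_normed_vector"
  shows "polar (\<i> *\<^sub>C x) (\<i> *\<^sub>C y) = polar x y"
proof -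
  have "\<i> *\<^sub>C (x - y) = \<i> *\<^sub>C x - \<i> *\<^sub>C y"
    using scaleC_add_right[of \<i> "x - y" y] by (simp add: algebra_simps)
  then have "norm (\<i> *\<^sub>C x - \<i> *\<^sub>C y) = norm (x - y)"
    using norm_scaleC[of \<i> "x - y"] by simp
  moreover have "norm (\<i> *\<^sub>C x + \<i> *\<^sub>C y) = norm (x + y)"
    using norm_scaleC[of \<i> "x + y"] by (simp add: scaleC_add_right)
  ultimately show ?thesis
    by (simp add: polar_def)
qed

lemma ficken_complex_inner_product:
  assumes "ficken TYPE('a::complex_normed_vector)"
  shows "\<exists>ip::'a \<Rightarrow> 'a \<Rightarrow> complex. complex_inner_product ip \<and>
    (\<forall>f. complex_of_real ((norm f)\<^sup>2) = ip f f)"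
proof -
  let ?ip = "\<lambda>x y::'a. Complex (polar x y) (polar x (\<i> *\<^sub>C y))"
  have ip: "complex_inner_product ?ip"
    using ficken_polar_inner_product[OF assms] by (rule complexify_inner_product) (rule polar_ii)
  then have "?ip f f \<in> \<real>" for f
    unfolding complex_inner_product_def by blast
  then have "complex_of_real ((norm f)\<^sup>2) = ?ip f f" for f
    by (simp add: complex_is_Real_iff complex_eq_iff polar_self)
  with ip show ?thesis
    by blast
qed

theorem theorem4:
  shows
    "((\<exists>x::'a::real_normed_vector. x \<noteq> 0) \<longrightarrow>
       ((\<exists>ip::'a \<Rightarrow> 'a \<Rightarrow> real. real_inner_product ip \<and> (\<forall>f. (norm f)\<^sup>2 = ip f f))
          \<longleftrightarrow> (\<exists>n\<ge>3. strongly_point_homogeneous n (UNIV :: 'a set))) \<and>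
       ((\<exists>n\<ge>3. strongly_point_homogeneous n (UNIV :: 'a set))
          \<longleftrightarrow> (\<forall>n\<ge>3. strongly_point_homogeneous n (UNIV :: 'a set)))) \<and>
     ((\<exists>x::'b::complex_normed_vector. x \<noteq> 0) \<longrightarrow>
       ((\<exists>ip::'b \<Rightarrow> 'b \<Rightarrow> complex. complex_inner_product ip \<and>
            (\<forall>f. complex_of_real ((norm f)\<^sup>2) = ip f f))
          \<longleftrightarrow> (\<exists>n\<ge>3. strongly_point_homogeneous n (UNIV :: 'b set))) \<and>
       ((\<exists>n\<ge>3. strongly_point_homogeneous n (UNIV :: 'b set))
          \<longleftrightarrow> (\<forall>n\<ge>3. strongly_point_homogeneous n (UNIV :: 'b set))))"
proof (intro conjI impI)
  \<comment> \<open>For either scalar field both equivalences follow from two implications: an inner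
    product gives homogeneity for every \<open>n\<close>, and homogeneity for a single
    \<open>n \<ge> 3\<close> gives an inner product.\<close>
  have real: "(\<exists>ip::'a \<Rightarrow> 'a \<Rightarrow> real. real_inner_product ip \<and> (\<forall>f. (norm f)\<^sup>2 = ip f f))
      \<Longrightarrow> strongly_point_homogeneous n (UNIV :: 'a set)" for n
    by (elim exE conjE) (rule inner_product_imp_homogeneous, assumption, blast)
  have real': "\<exists>ip::'a \<Rightarrow> 'a \<Rightarrow> real. real_inner_product ip \<and> (\<forall>f. (norm f)\<^sup>2 = ip f f)"
    if "\<exists>n\<ge>3. strongly_point_homogeneous n (UNIV :: 'a set)"
    using that ficken_polar_inner_product homogeneous_imp_ficken polar_self by metis
  show "(\<exists>ip::'a \<Rightarrow> 'a \<Rightarrow> real. real_inner_product ip \<and> (\<forall>f. (norm f)\<^sup>2 = ip f f))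
      \<longleftrightarrow> (\<exists>n\<ge>3. strongly_point_homogeneous n (UNIV :: 'a set))"
    using real real' by blast
  show "(\<exists>n\<ge>3. strongly_point_homogeneous n (UNIV :: 'a set))
      \<longleftrightarrow> (\<forall>n\<ge>3. strongly_point_homogeneous n (UNIV :: 'a set))"
    using real real' by blast
  have complex: "strongly_point_homogeneous n (UNIV :: 'b set)"
    if "\<exists>ip::'b \<Rightarrow> 'b \<Rightarrow> complex. complex_inner_product ip \<and>
      (\<forall>f. complex_of_real ((norm f)\<^sup>2) = ip f f)" for n
  proof -
    from that obtain ip :: "'b \<Rightarrow> 'b \<Rightarrow> complex" where "complex_inner_product ip"
      and norm: "\<And>f. complex_of_real ((norm f)\<^sup>2) = ip f f"
      by blast
    moreover have "(norm f)\<^sup>2 = Re (ip f f)" for f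
      by (metis norm Re_complex_of_real)
    ultimately show ?thesis
      using inner_product_imp_homogeneous complex_inner_product_Re by blast
  qed
  have complex': "\<exists>ip::'b \<Rightarrow> 'b \<Rightarrow> complex. complex_inner_product ip \<and>
      (\<forall>f. complex_of_real ((norm f)\<^sup>2) = ip f f)"
    if "\<exists>n\<ge>3. strongly_point_homogeneous n (UNIV :: 'b set)"
    using that ficken_complex_inner_product homogeneous_imp_ficken by blast
  show "(\<exists>ip::'b \<Rightarrow> 'b \<Rightarrow> complex. complex_inner_product ip \<and>
      (\<forall>f. complex_of_real ((norm f)\<^sup>2) = ip f f))
      \<longleftrightarrow> (\<exists>n\<ge>3. strongly_point_homogeneous n (UNIV :: 'b set))"
    using complex complex' by blast
  show "(\<exists>n\<ge>3. strongly_point_homogeneous n (UNIV :: 'b set))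
      \<longleftrightarrow> (\<forall>n\<ge>3. strongly_point_homogeneous n (UNIV :: 'b set))"
    using complex complex' by blast
qed

end
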